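(* For every continuous function $f:R^{\infty}\to R$ and every $T\in R^{\infty}$, $$(\delta)\int_{R^{\infty}}\delta(x-T)f(x)\,d\lambda(x)=f(T),$$ where the left-hand side means $\lim_{\epsilon\to 0+}\int_{R^{\infty}}\eta_{\epsilon}(x-T)f(x)\,d\lambda(x)$.
   Context: $R$ denotes the real line. $R^{\infty}=\prod_{k=1}^{\infty}R$ is the space of all real sequences with the Tychonoff (product) topology. $\lambda$ denotes a Baker measure on $R^{\infty}$: the completion of a translation-invariant Borel measure on $R^{\infty}$ such that $\lambda\big(\prod_{i=1}^{\infty}(a_i,b_i)\big)=\prod_{i=1}^{\infty}(b_i-a_i):=\lim_{n\to\infty}\prod_{i=1}^{n}(b_i-a_i)$ whenever $-\infty<a_i<b_i<+\infty$ for all $i$ and $0\le\prod_{i=1}^{\infty}(b_i-a_i)<+\infty$. For $\epsilon>0$ put $a_k(\epsilon)=\frac12 e^{-\frac{1}{2^k\epsilon}}$ for $k\ge 1$, and $\Delta_{\epsilon}=\prod_{k=1}^{\infty}[-a_k(\epsilon),a_k(\epsilon)]$. Its measure is $\lambda(\Delta_{\epsilon})=\prod_{k=1}^{\infty}2a_k(\epsilon)=e^{-\sum_{k=1}^{\infty}\frac{1}{2^k\epsilon}}$. Define $\eta_{\epsilon}:R^{\infty}\to R$ by $\eta_{\epsilon}(x)=e^{\sum_{k=1}^{\infty}\frac{1}{2^k\epsilon}}$ if $x\in\Delta_{\epsilon}$ and $\eta_{\epsilon}(x)=0$ otherwise. *)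

theory Defs
  imports "HOL-Analysis.Analysis" "HOL-Library.Function_Algebras"
begin

text \<open>
  The space of all real sequences is the type \<^typ>\<open>nat \<Rightarrow> real\<close> with its product topology and
  pointwise vector operations. Coordinates are numbered from 0, so coordinate \<open>i\<close> here
  is coordinate \<open>k = i + 1\<close> in the usual numbering.
\<close>

text \<open>
  The value of a box is the limit of its partial products of side lengths; the condition is
  imposed on exactly those boxes for which this limit exists and is finite (it may be 0).
\<close>

definition baker_borel_measure :: "(nat \<Rightarrow> real) measure \<Rightarrow> bool" where
  "baker_borel_measure \<mu> \<longleftrightarrow>
     sets \<mu> = sets borel \<and>
     (\<forall>v. \<forall>A\<in>sets borel. emeasure \<mu> ((+) v ` A) = emeasure \<mu> A) \<and>
     (\<forall>a b L. (\<forall>i. a i < b i) \<longrightarrow> (\<lambda>n. \<Prod>i<n. b i - a i) \<longlonglongrightarrow> L \<longrightarrow>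
        emeasure \<mu> (Pi UNIV (\<lambda>i. {a i<..<b i})) = ennreal L)"

definition baker_measure :: "(nat \<Rightarrow> real) measure \<Rightarrow> bool" where
  "baker_measure M \<longleftrightarrow> (\<exists>\<mu>. baker_borel_measure \<mu> \<and> M = completion \<mu>)"

definition half_side :: "real \<Rightarrow> nat \<Rightarrow> real" where
  "half_side \<epsilon> i = 1 / 2 * exp (- (1 / (2 ^ Suc i * \<epsilon>)))"

definition delta_box :: "real \<Rightarrow> (nat \<Rightarrow> real) set" where
  "delta_box \<epsilon> = Pi UNIV (\<lambda>i. {- half_side \<epsilon> i..half_side \<epsilon> i})"

definition delta_approx :: "real \<Rightarrow> (nat \<Rightarrow> real) \<Rightarrow> real" where
  "delta_approx \<epsilon> x = (if x \<in> delta_box \<epsilon> then exp (\<Sum>i. 1 / (2 ^ Suc i * \<epsilon>)) else 0)"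

end

theory Submission
  imports Defs "HOL-Real_Asymp.Real_Asymp"
begin

text \<open>
  The support \<open>T + \<Delta>\<^sub>\<epsilon>\<close> of the shifted kernel is a compact box. Each of its sides shrinks to a point
  as \<open>\<epsilon> \<rightarrow> 0+\<close>, and a neighbourhood of \<open>T\<close> in the product topology restricts only finitely many
  coordinates, so the boxes eventually enter every neighbourhood of \<open>T\<close>, although infinitely many of
  their sides stay close to \<open>1\<close>. Since the kernel has total mass \<open>1\<close>, the integral is an average of
  \<open>f\<close> over the box and tends to \<open>f T\<close>. The measure of the closed box is found by squeezing it
  between open boxes with \<open>1/\<epsilon>\<close> replaced by slightly smaller parameters.
\<close>

lemma sums_half_powers: "(\<lambda>i. c / 2 ^ Suc i) sums (c :: real)"
  using sums_mult[OF power_half_series, of c] by (simp add: power_one_over field_simps)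

text \<open>Parametrised by \<open>c\<close> in place of \<open>1 / \<epsilon>\<close>: the full
  side lengths multiply to \<open>exp (- c)\<close>, and two boxes with different parameters can be
  compared in all coordinates at once.\<close>

definition exp_radius :: "real \<Rightarrow> nat \<Rightarrow> real" where
  "exp_radius c i = 1 / 2 * exp (- (c / 2 ^ Suc i))"

lemma exp_radius_pos: "exp_radius c i > 0"
  by (simp add: exp_radius_def)

lemma exp_radius_strict_antimono: "c < d \<Longrightarrow> exp_radius d i < exp_radius c i"
  by (simp add: exp_radius_def divide_strict_right_mono)

lemma half_side_eq_exp_radius: "half_side \<epsilon> i = exp_radius (1 / \<epsilon>) i"
  by (simp add: half_side_def exp_radius_def mult.commute)

lemma prod_exp_radius_tendsto: "(\<lambda>n. \<Prod>i<n. 2 * exp_radius c i) \<longlonglongrightarrow> exp (- c)"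
proof -
  have "(\<lambda>n. exp (- (\<Sum>i<n. c / 2 ^ Suc i))) \<longlonglongrightarrow> exp (- c)"
    using sums_half_powers[of c] unfolding sums_def by (intro tendsto_intros)
  then show ?thesis
    by (simp add: exp_radius_def exp_sum sum_negf[symmetric])
qed

definition closed_box :: "(nat \<Rightarrow> real) \<Rightarrow> (nat \<Rightarrow> real) \<Rightarrow> (nat \<Rightarrow> real) set" where
  "closed_box T r = Pi UNIV (\<lambda>i. {T i - r i..T i + r i})"

text \<open>This is Tychonoff's theorem. It serves twice: it makes the box closed, hence Borel, and
  it bounds a continuous \<open>f\<close> on the box.\<close>

lemma compact_closed_box: "compact (closed_box T r)"
proof -
  have "compactin (product_topology (\<lambda>i. euclidean) UNIV)
          (PiE UNIV (\<lambda>i. {T i - r i..T i + r i}))"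
    by (subst compactin_PiE) auto
  then show ?thesis
    by (simp add: closed_box_def euclidean_product_topology PiE_UNIV_domain)
qed

lemma closed_box_in_sets_borel: "closed_box T r \<in> sets borel"
  by (intro borel_closed compact_imp_closed compact_closed_box)

lemma emeasure_open_exp_box:
  assumes "baker_borel_measure \<mu>"
  shows "emeasure \<mu> (Pi UNIV (\<lambda>i. {T i - exp_radius c i<..<T i + exp_radius c i}))
           = ennreal (exp (- c))"
proof (rule assms[unfolded baker_borel_measure_def, THEN conjunct2, THEN conjunct2, rule_format])
  show "T i - exp_radius c i < T i + exp_radius c i" for i
    using exp_radius_pos[of c i] by simp
  show "(\<lambda>n. \<Prod>i<n. (T i + exp_radius c i) - (T i - exp_radius c i)) \<longlonglongrightarrow> exp (- c)"
    using prod_exp_radius_tendsto[of c] by simp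
qed

text \<open>A product of infinitely many bounded open intervals is not open in the product topology,
  but it is a countable intersection of open cylinders.\<close>

lemma open_Pi_greaterThanLessThan_in_sets_borel:
  fixes a b :: "nat \<Rightarrow> real"
  shows "Pi UNIV (\<lambda>i. {a i<..<b i}) \<in> sets borel"
proof -
  have "Pi UNIV (\<lambda>i. {a i<..<b i}) = (\<Inter>i. (\<lambda>x. x i) -` {a i<..<b i})"
    by (auto simp: Pi_def)
  also have "\<dots> \<in> sets borel"
    by (intro sets.countable_INT'' borel_open open_vimage continuous_intros) auto
  finally show ?thesis .
qed

text \<open>Only boxes with open sides have a prescribed measure. Enlarging every side by one fixed
  factor above 1 would make the product diverge. Lowering the parameter from \<open>c\<close> to
  \<open>d\<close> multiplies side \<open>i\<close> by \<open>exp ((c - d) / 2 ^ Suc i)\<close>, and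
  these factors have the finite product \<open>exp (c - d)\<close>, which tends to 1.\<close>

lemma emeasure_closed_exp_box:
  assumes mu: "baker_borel_measure \<mu>"
  shows "emeasure \<mu> (closed_box T (exp_radius c)) = ennreal (exp (- c))"
proof (rule antisym)
  have [simp]: "sets \<mu> = sets borel"
    using mu by (simp add: baker_borel_measure_def)
  have upper: "emeasure \<mu> (closed_box T (exp_radius c)) \<le> ennreal (exp (- d))" if "d < c" for d
  proof -
    have "closed_box T (exp_radius c)
            \<subseteq> Pi UNIV (\<lambda>i. {T i - exp_radius d i<..<T i + exp_radius d i})"
      unfolding closed_box_def
    proof (intro Pi_mono)
      show "{T i - exp_radius c i..T i + exp_radius c i}
              \<subseteq> {T i - exp_radius d i<..<T i + exp_radius d i}" for i
        using exp_radius_strict_antimono[OF that, of i] by auto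
    qed
    from emeasure_mono[OF this, of \<mu>] show ?thesis
      by (simp add: emeasure_open_exp_box[OF mu] open_Pi_greaterThanLessThan_in_sets_borel)
  qed
  have "((\<lambda>d. ennreal (exp (- d))) \<longlongrightarrow> ennreal (exp (- c))) (at_left c)"
    by (intro tendsto_intros)
  then show "emeasure \<mu> (closed_box T (exp_radius c)) \<le> ennreal (exp (- c))"
    by (rule tendsto_lowerbound)
       \<comment> \<open>The bound \<open>c - 1\<close> is arbitrary; any left neighbourhood of
         \<open>c\<close> would do.\<close>
       (auto intro!: upper eventually_mono[OF eventually_at_left_real[of "c - 1" c]])
  have "Pi UNIV (\<lambda>i. {T i - exp_radius c i<..<T i + exp_radius c i}) \<subseteq> closed_box T (exp_radius c)"
    unfolding closed_box_def by (intro Pi_mono) auto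
  from emeasure_mono[OF this, of \<mu>]
  show "ennreal (exp (- c)) \<le> emeasure \<mu> (closed_box T (exp_radius c))"
    by (simp add: emeasure_open_exp_box[OF mu] closed_box_in_sets_borel)
qed

text \<open>The radii converge in each coordinate separately, with no uniformity in
  \<open>i\<close>. This is enough because a basic neighbourhood yields finitely many nontrivial
  conditions, and finitely many eventual statements hold jointly.\<close>

lemma eventually_closed_box_subset:
  assumes "open U" "T \<in> U" and r: "\<And>i. ((\<lambda>\<epsilon>. r \<epsilon> i) \<longlongrightarrow> 0) F"
  shows "\<forall>\<^sub>F \<epsilon> in F. closed_box T (r \<epsilon>) \<subseteq> U"
proof -
  have "openin (product_topology (\<lambda>i. euclidean) UNIV) U"
    using \<open>open U\<close> by (simp add: euclidean_product_topology)
  from product_topology_open_contains_basis[OF this \<open>T \<in> U\<close>]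
  obtain X where X: "T \<in> PiE UNIV X" "\<And>i. open (X i)" "finite {i. X i \<noteq> UNIV}" "PiE UNIV X \<subseteq> U"
    by auto
  have "\<forall>\<^sub>F \<epsilon> in F. {T i - r \<epsilon> i..T i + r \<epsilon> i} \<subseteq> X i" for i
  proof -
    obtain \<rho> where "\<rho> > 0" and \<rho>: "ball (T i) \<rho> \<subseteq> X i"
      using X(1) open_contains_ball X(2)[of i] by (metis PiE_mem UNIV_I)
    from order_tendstoD(2)[OF r[of i] this(1)] show ?thesis
    proof eventually_elim
      case (elim \<epsilon>)
      then have "{T i - r \<epsilon> i..T i + r \<epsilon> i} \<subseteq> ball (T i) \<rho>"
        by (auto simp: dist_real_def)
      with \<rho> show ?case by blast
    qed
  qed
  then have "\<forall>\<^sub>F \<epsilon> in F. \<forall>i\<in>{i. X i \<noteq> UNIV}. {T i - r \<epsilon> i..T i + r \<epsilon> i} \<subseteq> X i"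
    by (intro eventually_ball_finite X(3)) blast
  then show ?thesis
  proof eventually_elim
    case (elim \<epsilon>)
    then have "closed_box T (r \<epsilon>) \<subseteq> Pi UNIV X"
      unfolding closed_box_def by (intro Pi_mono) blast
    with X(4) show ?case by (simp add: PiE_UNIV_domain)
  qed
qed

lemma half_side_tendsto_0: "((\<lambda>\<epsilon>. half_side \<epsilon> i) \<longlongrightarrow> 0) (at_right 0)"
proof -
  \<comment> \<open>The coordinate enters only through the positive constant
    \<open>2 ^ Suc i\<close>, abstracted here to \<open>c\<close>.\<close>
  have "((\<lambda>\<epsilon>. 1 / 2 * exp (- (1 / (c * \<epsilon>)))) \<longlongrightarrow> 0) (at_right 0)" if "c > 0" for c :: real
    using that by real_asymp
  from this[of "2 ^ Suc i"] show ?thesis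
    by (simp add: half_side_def)
qed

text \<open>The geometric series collapses the height of the kernel to
  \<open>exp (1 / \<epsilon>)\<close>, the reciprocal of the measure of the box. At
  \<open>\<epsilon> = 0\<close> both exponents are 0 by the convention for division.\<close>

lemma delta_approx_shift:
  "delta_approx \<epsilon> (x - T) = exp (1 / \<epsilon>) * indicator (closed_box T (half_side \<epsilon>)) x"
proof -
  have "(\<lambda>i. 1 / (2 ^ Suc i * \<epsilon>)) sums (1 / \<epsilon>)"
    using sums_half_powers[of "1 / \<epsilon>"] by (simp add: mult.commute)
  from sums_unique[OF this] have "(\<Sum>i. 1 / (2 ^ Suc i * \<epsilon>)) = 1 / \<epsilon>" by simp
  moreover have "x - T \<in> delta_box \<epsilon> \<longleftrightarrow> x \<in> closed_box T (half_side \<epsilon>)"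
    by (auto simp: delta_box_def closed_box_def Pi_iff algebra_simps)
  ultimately show ?thesis
    by (simp add: delta_approx_def)
qed

context
  fixes \<mu> :: "(nat \<Rightarrow> real) measure"
  assumes mu: "baker_borel_measure \<mu>"
begin

lemma sets_baker_borel_measure: "sets \<mu> = sets borel"
  using mu by (simp add: baker_borel_measure_def)

lemma emeasure_closed_box_half_side:
  "emeasure \<mu> (closed_box T (half_side \<epsilon>)) = ennreal (exp (- (1 / \<epsilon>)))"
proof -
  have "half_side \<epsilon> = exp_radius (1 / \<epsilon>)"
    by (simp add: half_side_eq_exp_radius fun_eq_iff)
  then show ?thesis
    using emeasure_closed_exp_box[OF mu] by simp
qed

text \<open>Although \<open>f\<close> may be unbounded on the whole space, the kernel cuts it down
  to a compact box of finite measure, where it is bounded.\<close>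

lemma integrable_delta_approx:
  assumes f: "continuous_on UNIV f"
  shows "integrable \<mu> (\<lambda>x. delta_approx \<epsilon> (x - T) * f x)"
proof -
  let ?B = "closed_box T (half_side \<epsilon>)"
  have "compact (f ` ?B)"
    by (intro compact_continuous_image continuous_on_subset[OF f] compact_closed_box) auto
  then obtain C where "\<And>x. x \<in> ?B \<Longrightarrow> norm (f x) \<le> C"
    by (meson bounded_iff compact_imp_bounded imageI)
  moreover have "f \<in> borel_measurable \<mu>"
    using borel_measurable_continuous_onI[OF f] measurable_cong_sets[OF sets_baker_borel_measure refl]
    by blast
  ultimately have "integrable \<mu> (\<lambda>x. indicator ?B x *\<^sub>R f x)"
    by (intro integrableI_bounded_set_indicator[where B = C])
       (auto simp: sets_baker_borel_measure closed_box_in_sets_borel emeasure_closed_box_half_side)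
  then have "integrable \<mu> (\<lambda>x. exp (1 / \<epsilon>) * (indicator ?B x *\<^sub>R f x))"
    by (rule integrable_mult_right)
  then show ?thesis
    by (simp add: delta_approx_shift mult.assoc)
qed

lemma integral_delta_approx: "(\<integral>x. delta_approx \<epsilon> (x - T) \<partial>\<mu>) = 1"
proof -
  have "measure \<mu> (closed_box T (half_side \<epsilon>)) = exp (- (1 / \<epsilon>))"
    by (simp add: measure_def emeasure_closed_box_half_side)
  then show ?thesis
    by (simp add: delta_approx_shift exp_minus sets_eq_imp_space_eq[OF sets_baker_borel_measure])
qed

lemma integral_delta_approx_tendsto:
  assumes f: "continuous_on UNIV f"
  shows "((\<lambda>\<epsilon>. \<integral>x. delta_approx \<epsilon> (x - T) * f x \<partial>\<mu>) \<longlongrightarrow> f T) (at_right 0)"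
proof (rule tendstoI)
  fix e :: real
  assume "e > 0"
  \<comment> \<open>Integration preserves only the non-strict bound, so \<open>e / 2\<close> leaves
    room for the strict inequality with \<open>e\<close>.\<close>
  define U where "U = f -` ball (f T) (e / 2)"
  have "open U"
    unfolding U_def using f by (intro open_vimage) auto
  moreover have "T \<in> U"
    using \<open>e > 0\<close> by (simp add: U_def)
  ultimately have "\<forall>\<^sub>F \<epsilon> in at_right 0. closed_box T (half_side \<epsilon>) \<subseteq> U"
    using half_side_tendsto_0 by (rule eventually_closed_box_subset)
  then show "\<forall>\<^sub>F \<epsilon> in at_right 0. dist (\<integral>x. delta_approx \<epsilon> (x - T) * f x \<partial>\<mu>) (f T) < e"
  proof eventually_elim
    case (elim \<epsilon>)
    let ?D = "\<lambda>x. delta_approx \<epsilon> (x - T)"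
    have int: "integrable \<mu> (\<lambda>x. ?D x * g x)" if "continuous_on UNIV g" for g
      using that by (rule integrable_delta_approx)
    have D_nonneg: "?D x \<ge> 0" for x
      by (simp add: delta_approx_def)
    \<comment> \<open>Since the kernel has unit mass, \<open>f T\<close> is itself an integral
      against it, and the two integrals can be subtracted.\<close>
    have "(\<integral>x. ?D x * f x \<partial>\<mu>) - f T = (\<integral>x. ?D x * f x \<partial>\<mu>) - (\<integral>x. ?D x * f T \<partial>\<mu>)"
      by (simp add: integral_delta_approx)
    also have "\<dots> = (\<integral>x. ?D x * (f x - f T) \<partial>\<mu>)"
      using int[OF f] int[of "\<lambda>_. f T"]
      by (subst Bochner_Integration.integral_diff[symmetric]) (auto simp: right_diff_distrib)
    also have "\<bar>\<dots>\<bar> \<le> (\<integral>x. \<bar>?D x * (f x - f T)\<bar> \<partial>\<mu>)"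
      by (rule integral_abs_bound)
    also have "\<dots> \<le> (\<integral>x. ?D x * (e / 2) \<partial>\<mu>)"
    proof (rule integral_mono)
      show "integrable \<mu> (\<lambda>x. \<bar>?D x * (f x - f T)\<bar>)"
        by (intro integrable_abs int continuous_intros f)
      show "integrable \<mu> (\<lambda>x. ?D x * (e / 2))"
        by (intro int continuous_intros)
      show "\<bar>?D x * (f x - f T)\<bar> \<le> ?D x * (e / 2)" for x
      proof (cases "x \<in> closed_box T (half_side \<epsilon>)")
        case True
        then have "\<bar>f x - f T\<bar> \<le> e / 2"
          using elim by (auto simp: U_def dist_real_def abs_minus_commute intro: less_imp_le)
        then show ?thesis
          using D_nonneg[of x] by (simp only: abs_mult abs_of_nonneg mult_left_mono)
      qed (simp add: delta_approx_shift)
    qed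
    also have "\<dots> = e / 2"
      by (simp add: integral_delta_approx)
    finally show ?case
      using \<open>e > 0\<close> by (simp add: dist_real_def)
  qed
qed

end

theorem theorem5p4:
  fixes lam :: "(nat \<Rightarrow> real) measure"
    and f :: "(nat \<Rightarrow> real) \<Rightarrow> real"
    and T :: "nat \<Rightarrow> real"
  assumes "baker_measure lam"
    and "continuous_on UNIV f"
  shows "(\<forall>\<epsilon>>0. integrable lam (\<lambda>x. delta_approx \<epsilon> (x - T) * f x)) \<and>
         ((\<lambda>\<epsilon>. \<integral>x. delta_approx \<epsilon> (x - T) * f x \<partial>lam) \<longlongrightarrow> f T) (at_right 0)"
proof -
  obtain \<mu> where mu: "baker_borel_measure \<mu>" and lam: "lam = completion \<mu>"
    using assms(1) unfolding baker_measure_def by blast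
  note int = integrable_delta_approx[OF mu assms(2)]
  \<comment> \<open>The integrand is measurable already for the Borel measure, so completion changes
    neither its integrability nor its integral.\<close>
  have "(\<lambda>x. delta_approx \<epsilon> (x - T) * f x) \<in> borel_measurable \<mu>" for \<epsilon>
    using int by (rule borel_measurable_integrable)
  then show ?thesis
    using int integral_delta_approx_tendsto[OF mu assms(2), of T]
    by (simp add: lam integrable_completion integral_completion)
qed

end
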